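(* Let $A$ be a perm subalgebra of a perm algebra $E$, and let $V$ be a given $A$-complement of $E$ with associated matched pair $(A,V,\blacktriangleright,\blacktriangleleft,\triangleright,\triangleleft)$. (i) Let $\psi:V\to A$ be a deformation map of this matched pair. Then the vector space $V$ with the new product $$v_1\cdot_\psi v_2=v_1v_2+\psi(v_1)\blacktriangleright v_2+v_1\blacktriangleleft\psi(v_2)$$ is a perm algebra, denoted $V_\psi$ (the $\psi$-deformation of $V$), and $V_\psi$ is (isomorphic as a perm algebra to) an $A$-complement of $E$. (ii) A perm algebra $V'$ is (isomorphic to) an $A$-complement of $E$ if and only if $V'$ is isomorphic to $V_\psi$ for some deformation map $\psi:V\to A$ of the matched pair $(A,V,\blacktriangleright,\blacktriangleleft,\triangleright,\triangleleft)$.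
   Context: All vector spaces are over a field $\mathbb{K}$ of characteristic zero. A perm algebra is a vector space $A$ with a bilinear product satisfying $(a_1a_2)a_3=a_1(a_2a_3)=a_1(a_3a_2)$ for all $a_1,a_2,a_3\in A$ (no unit is required). For a perm subalgebra $A$ of $E$, an $A$-complement of $E$ is a perm subalgebra $V$ of $E$ with $E=A+V$ and $A\cap V=\{0\}$. The associated matched pair consists of the bilinear maps $\blacktriangleright:A\times V\to V$, $\blacktriangleleft:V\times A\to V$, $\triangleright:V\times A\to A$, $\triangleleft:A\times V\to A$ determined by decomposing the products of $E$ along $E=A\oplus V$: $av=a\triangleleft v+a\blacktriangleright v$ and $va=v\triangleright a+v\blacktriangleleft a$ for $a\in A$, $v\in V$. A linear map $\psi:V\to A$ is a deformation map of the matched pair if for all $v_1,v_2\in V$ $$\psi(v_1v_2)-\psi(v_1)\psi(v_2)=v_1\triangleright\psi(v_2)+\psi(v_1)\triangleleft v_2-\psi(\psi(v_1)\blacktriangleright v_2)-\psi(v_1\blacktriangleleft\psi(v_2)),$$ where $v_1v_2$ is the product of $V$ and $\psi(v_1)\psi(v_2)$ is the product of $A$. *)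

theory Defs
  imports Complex_Main
begin

(* Every algebra lives on a carrier set, a linear subspace of the vector space given by the
   type 'a and scale; the product is constrained only on the carrier. *)
locale perm_algebra = vector_space scale
  for scale :: "'k::field_char_0 \<Rightarrow> 'a::ab_group_add \<Rightarrow> 'a" +
  fixes S :: "'a set" and mult :: "'a \<Rightarrow> 'a \<Rightarrow> 'a"
  assumes subspace_carrier: "subspace S"
    and mult_closed: "x \<in> S \<Longrightarrow> y \<in> S \<Longrightarrow> mult x y \<in> S"
    and mult_add_left: "x \<in> S \<Longrightarrow> y \<in> S \<Longrightarrow> z \<in> S \<Longrightarrow> mult (x + y) z = mult x z + mult y z"
    and mult_add_right: "x \<in> S \<Longrightarrow> y \<in> S \<Longrightarrow> z \<in> S \<Longrightarrow> mult x (y + z) = mult x y + mult x z"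
    and mult_scale_left: "x \<in> S \<Longrightarrow> y \<in> S \<Longrightarrow> mult (scale c x) y = scale c (mult x y)"
    and mult_scale_right: "x \<in> S \<Longrightarrow> y \<in> S \<Longrightarrow> mult x (scale c y) = scale c (mult x y)"
    and mult_assoc: "x \<in> S \<Longrightarrow> y \<in> S \<Longrightarrow> z \<in> S \<Longrightarrow> mult (mult x y) z = mult x (mult y z)"
    and mult_perm: "x \<in> S \<Longrightarrow> y \<in> S \<Longrightarrow> z \<in> S \<Longrightarrow> mult x (mult y z) = mult x (mult z y)"

definition perm_subalgebra ::
  "('k::field_char_0 \<Rightarrow> 'a::ab_group_add \<Rightarrow> 'a) \<Rightarrow> 'a set \<Rightarrow> ('a \<Rightarrow> 'a \<Rightarrow> 'a) \<Rightarrow> 'a set \<Rightarrow> bool"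
  where "perm_subalgebra scale E mult B \<longleftrightarrow>
    B \<subseteq> E \<and> module.subspace scale B \<and> (\<forall>x\<in>B. \<forall>y\<in>B. mult x y \<in> B)"

definition is_complement ::
  "('k::field_char_0 \<Rightarrow> 'a::ab_group_add \<Rightarrow> 'a) \<Rightarrow> 'a set \<Rightarrow> ('a \<Rightarrow> 'a \<Rightarrow> 'a) \<Rightarrow> 'a set \<Rightarrow> 'a set \<Rightarrow> bool"
  where "is_complement scale E mult A V \<longleftrightarrow>
    perm_subalgebra scale E mult V \<and> E = {a + v | a v. a \<in> A \<and> v \<in> V} \<and> A \<inter> V = {0}"

definition linear_on ::
  "('k::field_char_0 \<Rightarrow> 'a::ab_group_add \<Rightarrow> 'a) \<Rightarrow> ('k \<Rightarrow> 'b::ab_group_add \<Rightarrow> 'b) \<Rightarrow> 'a set \<Rightarrow> ('a \<Rightarrow> 'b) \<Rightarrow> bool"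
  where "linear_on s1 s2 S f \<longleftrightarrow>
    (\<forall>x\<in>S. \<forall>y\<in>S. f (x + y) = f x + f y) \<and> (\<forall>c. \<forall>x\<in>S. f (s1 c x) = s2 c (f x))"

definition perm_isomorphic ::
  "('k::field_char_0 \<Rightarrow> 'a::ab_group_add \<Rightarrow> 'a) \<Rightarrow> 'a set \<Rightarrow> ('a \<Rightarrow> 'a \<Rightarrow> 'a) \<Rightarrow>
   ('k \<Rightarrow> 'b::ab_group_add \<Rightarrow> 'b) \<Rightarrow> 'b set \<Rightarrow> ('b \<Rightarrow> 'b \<Rightarrow> 'b) \<Rightarrow> bool"
  where "perm_isomorphic s1 S1 m1 s2 S2 m2 \<longleftrightarrow>
    (\<exists>f. linear_on s1 s2 S1 f \<and> bij_betw f S1 S2 \<and> (\<forall>x\<in>S1. \<forall>y\<in>S1. f (m1 x y) = m2 (f x) (f y)))"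

(* summand B C x is the B-component of x along the direct sum of B and C;
   meaningful only if x is in B + C and B, C meet trivially. *)
definition summand :: "'a::ab_group_add set \<Rightarrow> 'a set \<Rightarrow> 'a \<Rightarrow> 'a"
  where "summand B C x = (THE b. b \<in> B \<and> (\<exists>c\<in>C. x = b + c))"

(* The matched pair of A and a complement V, named after the triangle symbols that usually
   denote the four maps (by colour and pointing direction):
     a v = white_left a v + black_right a v,   v a = white_right v a + black_left v a,
   the white ones having values in A and the black ones in V. *)
definition white_left :: "'a::ab_group_add set \<Rightarrow> 'a set \<Rightarrow> ('a \<Rightarrow> 'a \<Rightarrow> 'a) \<Rightarrow> 'a \<Rightarrow> 'a \<Rightarrow> 'a"
  where "white_left A V mult a v = summand A V (mult a v)"

definition black_right :: "'a::ab_group_add set \<Rightarrow> 'a set \<Rightarrow> ('a \<Rightarrow> 'a \<Rightarrow> 'a) \<Rightarrow> 'a \<Rightarrow> 'a \<Rightarrow> 'a"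
  where "black_right A V mult a v = summand V A (mult a v)"

definition white_right :: "'a::ab_group_add set \<Rightarrow> 'a set \<Rightarrow> ('a \<Rightarrow> 'a \<Rightarrow> 'a) \<Rightarrow> 'a \<Rightarrow> 'a \<Rightarrow> 'a"
  where "white_right A V mult v a = summand A V (mult v a)"

definition black_left :: "'a::ab_group_add set \<Rightarrow> 'a set \<Rightarrow> ('a \<Rightarrow> 'a \<Rightarrow> 'a) \<Rightarrow> 'a \<Rightarrow> 'a \<Rightarrow> 'a"
  where "black_left A V mult v a = summand V A (mult v a)"

lemma matched_pair_decomposition:
  assumes "perm_algebra scale E mult" "perm_subalgebra scale E mult A" "is_complement scale E mult A V"
    and "a \<in> A" "v \<in> V"
  shows "mult a v = white_left A V mult a v + black_right A V mult a v"
    and "mult v a = white_right A V mult v a + black_left A V mult v a"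
    and "white_left A V mult a v \<in> A" "white_right A V mult v a \<in> A"
    and "black_right A V mult a v \<in> V" "black_left A V mult v a \<in> V"
proof -
  interpret perm_algebra scale E mult by fact
  have A: "subspace A" "A \<subseteq> E" and V: "subspace V" "V \<subseteq> E"
    and sum: "E = {a + v | a v. a \<in> A \<and> v \<in> V}" and int: "A \<inter> V = {0}"
    using assms by (auto simp: perm_subalgebra_def is_complement_def)
  have uniq: "b = b' \<and> w = w'"
    if "b \<in> A" "b' \<in> A" "w \<in> V" "w' \<in> V" "b + w = b' + w'" for b b' w w'
  proof -
    have "b - b' = w' - w" using that(5) by (simp add: algebra_simps)
    then have "b - b' \<in> A \<inter> V"
      using subspace_diff[OF A(1) that(1,2)] subspace_diff[OF V(1) that(4,3)] by simp
    then show ?thesis using int that(5) by auto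
  qed
  have comps: "x = summand A V x + summand V A x \<and> summand A V x \<in> A \<and> summand V A x \<in> V"
    if "x \<in> E" for x
  proof -
    obtain b w where bw: "b \<in> A" "w \<in> V" "x = b + w" using \<open>x \<in> E\<close> sum by auto
    have "summand A V x = b" unfolding summand_def
      by (rule the_equality) (use bw uniq in blast)+
    moreover have "summand V A x = w" unfolding summand_def
      by (rule the_equality) (use bw uniq in \<open>metis add.commute\<close>)+
    ultimately show ?thesis using bw by simp
  qed
  have "mult a v \<in> E" "mult v a \<in> E" using assms(4,5) A(2) V(2) mult_closed by blast+
  from comps[OF this(1)] comps[OF this(2)]
  show "mult a v = white_left A V mult a v + black_right A V mult a v"
    and "mult v a = white_right A V mult v a + black_left A V mult v a"
    and "white_left A V mult a v \<in> A" "white_right A V mult v a \<in> A"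
    and "black_right A V mult a v \<in> V" "black_left A V mult v a \<in> V"
    by (auto simp: white_left_def black_right_def white_right_def black_left_def)
qed

(* Only the values of \<psi> on V matter. *)
definition deformation_map ::
  "('k::field_char_0 \<Rightarrow> 'a::ab_group_add \<Rightarrow> 'a) \<Rightarrow> 'a set \<Rightarrow> 'a set \<Rightarrow> ('a \<Rightarrow> 'a \<Rightarrow> 'a) \<Rightarrow> ('a \<Rightarrow> 'a) \<Rightarrow> bool"
  where "deformation_map scale A V mult \<psi> \<longleftrightarrow>
    \<psi> ` V \<subseteq> A \<and> linear_on scale scale V \<psi> \<and>
    (\<forall>v1\<in>V. \<forall>v2\<in>V.
      \<psi> (mult v1 v2) - mult (\<psi> v1) (\<psi> v2) =
        white_right A V mult v1 (\<psi> v2) + white_left A V mult (\<psi> v1) v2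
        - \<psi> (black_right A V mult (\<psi> v1) v2) - \<psi> (black_left A V mult v1 (\<psi> v2)))"

definition deformed_mult ::
  "'a::ab_group_add set \<Rightarrow> 'a set \<Rightarrow> ('a \<Rightarrow> 'a \<Rightarrow> 'a) \<Rightarrow> ('a \<Rightarrow> 'a) \<Rightarrow> 'a \<Rightarrow> 'a \<Rightarrow> 'a"
  where "deformed_mult A V mult \<psi> v1 v2 =
    mult v1 v2 + black_right A V mult (\<psi> v1) v2 + black_left A V mult v1 (\<psi> v2)"

end

theory Submission
  imports Defs
begin

text \<open>
  A linear map \<open>\<psi> : V \<rightarrow> A\<close> is determined by its graph \<open>{\<psi> v + v | v \<in> V}\<close>, and the graphs of
  such maps are exactly the linear complements of \<open>A\<close> in \<open>E\<close>: such a complement \<open>B\<close> is the graph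
  of the map sending \<open>v\<close> to the unique \<open>a \<in> A\<close> with \<open>a + v \<in> B\<close>
  (\<open>complement_eq_graph\<close>).  For \<open>v, w \<in> V\<close> the product \<open>(\<psi> v + v)(\<psi> w + w)\<close> has as its
  \<open>V\<close>-component the deformed product \<open>v \<cdot>\<^sub>\<psi> w\<close>, and the defining identity of a deformation map says
  precisely that its \<open>A\<close>-component is \<open>\<psi> (v \<cdot>\<^sub>\<psi> w)\<close>.  Hence \<open>\<psi>\<close> is a deformation map if and only if
  its graph is closed under the product (\<open>deformation_map_iff_subalgebra_graph\<close>), and then
  \<open>v \<mapsto> \<psi> v + v\<close> is a linear bijection from \<open>V\<close> onto the graph that carries \<open>\<cdot>\<^sub>\<psi>\<close> to the product of
  \<open>E\<close>.  Transporting the perm identities back along it makes \<open>V\<^sub>\<psi>\<close> a perm algebra isomorphic to the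
  graph, so the complements of \<open>A\<close> are, up to isomorphism, exactly the deformations \<open>V\<^sub>\<psi>\<close>.
\<close>

section \<open>Isomorphisms and transport of perm algebra structures\<close>

lemma perm_isomorphic_trans:
  assumes "perm_isomorphic s1 S1 m1 s2 S2 m2" "perm_isomorphic s2 S2 m2 s3 S3 m3"
  shows "perm_isomorphic s1 S1 m1 s3 S3 m3"
proof -
  obtain f where f: "linear_on s1 s2 S1 f" "bij_betw f S1 S2"
      "\<forall>x\<in>S1. \<forall>y\<in>S1. f (m1 x y) = m2 (f x) (f y)"
    using assms(1) unfolding perm_isomorphic_def by blast
  obtain g where g: "linear_on s2 s3 S2 g" "bij_betw g S2 S3"
      "\<forall>x\<in>S2. \<forall>y\<in>S2. g (m2 x y) = m3 (g x) (g y)"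
    using assms(2) unfolding perm_isomorphic_def by blast
  have im: "f x \<in> S2" if "x \<in> S1" for x
    using f(2) that by (rule bij_betw_apply)
  have "linear_on s1 s3 S1 (g \<circ> f)"
    using f(1) g(1) im by (simp add: linear_on_def)
  moreover have "bij_betw (g \<circ> f) S1 S3"
    using f(2) g(2) by (rule bij_betw_trans)
  moreover have "\<forall>x\<in>S1. \<forall>y\<in>S1. (g \<circ> f) (m1 x y) = m3 ((g \<circ> f) x) ((g \<circ> f) y)"
    using f(3) g(3) im by simp
  ultimately show ?thesis
    unfolding perm_isomorphic_def by blast
qed

lemma perm_isomorphic_sym:
  assumes "perm_algebra s1 S1 m1" "perm_isomorphic s1 S1 m1 s2 S2 m2"
  shows "perm_isomorphic s2 S2 m2 s1 S1 m1"
proof -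
  interpret perm_algebra s1 S1 m1 by fact
  obtain f where lin: "linear_on s1 s2 S1 f" and bij: "bij_betw f S1 S2"
      and hom: "\<forall>x\<in>S1. \<forall>y\<in>S1. f (m1 x y) = m2 (f x) (f y)"
    using assms(2) unfolding perm_isomorphic_def by blast
  define g where "g = inv_into S1 f"
  have gS: "g y \<in> S1" and fg: "f (g y) = y" if "y \<in> S2" for y
    using that bij by (auto simp: g_def bij_betw_def inv_into_into f_inv_into_f)
  have gf: "g (f x) = x" if "x \<in> S1" for x
    using that bij by (simp add: g_def bij_betw_def)
  have "g (x + y) = g x + g y" if "x \<in> S2" "y \<in> S2" for x y
  proof -
    have "f (g x + g y) = x + y"
      using lin gS fg that by (simp add: linear_on_def)
    then show ?thesis
      using gf[OF subspace_add[OF subspace_carrier gS gS]] that by metis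
  qed
  moreover have "g (s2 c x) = s1 c (g x)" if "x \<in> S2" for c x
  proof -
    have "f (s1 c (g x)) = s2 c x"
      using lin gS fg that by (simp add: linear_on_def)
    then show ?thesis
      using gf[OF subspace_scale[OF subspace_carrier gS]] that by metis
  qed
  ultimately have "linear_on s2 s1 S2 g"
    by (simp add: linear_on_def)
  moreover have "bij_betw g S2 S1"
    unfolding g_def using bij by (rule bij_betw_inv_into)
  moreover have "g (m2 x y) = m1 (g x) (g y)" if "x \<in> S2" "y \<in> S2" for x y
  proof -
    have "f (m1 (g x) (g y)) = m2 x y"
      using hom gS fg that by simp
    then show ?thesis
      using gf[OF mult_closed[OF gS gS]] that by metis
  qed
  ultimately show ?thesis
    unfolding perm_isomorphic_def by blast
qed

text \<open>The perm algebra axioms pull back along a linear injection that respects the products.\<close>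

lemma perm_algebra_pullback:
  assumes alg: "perm_algebra s2 S2 m2"
    and vs: "vector_space s1" and sub: "module.subspace s1 S1"
    and closed: "\<And>x y. x \<in> S1 \<Longrightarrow> y \<in> S1 \<Longrightarrow> m1 x y \<in> S1"
    and lin: "linear_on s1 s2 S1 f" and inj: "inj_on f S1"
    and im: "\<And>x. x \<in> S1 \<Longrightarrow> f x \<in> S2"
    and hom: "\<And>x y. x \<in> S1 \<Longrightarrow> y \<in> S1 \<Longrightarrow> f (m1 x y) = m2 (f x) (f y)"
  shows "perm_algebra s1 S1 m1"
proof -
  interpret T: perm_algebra s2 S2 m2 by fact
  interpret vector_space s1 by fact
  have f_add: "f (x + y) = f x + f y" if "x \<in> S1" "y \<in> S1" for x y
    using lin that by (simp add: linear_on_def)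
  have f_scale: "f (s1 c x) = s2 c (f x)" if "x \<in> S1" for c x
    using lin that by (simp add: linear_on_def)
  note S1 = closed subspace_add[OF sub] subspace_scale[OF sub]
  note f = S1 f_add f_scale hom im
  show ?thesis
  proof
    show "subspace S1" by fact
    fix x y z c
    assume x: "x \<in> S1" and y: "y \<in> S1"
    then show "m1 x y \<in> S1" by (rule closed)
    show "m1 (s1 c x) y = s1 c (m1 x y)"
      by (rule inj_onD[OF inj]) (simp_all add: x y f T.mult_scale_left)
    show "m1 x (s1 c y) = s1 c (m1 x y)"
      by (rule inj_onD[OF inj]) (simp_all add: x y f T.mult_scale_right)
    assume z: "z \<in> S1"
    show "m1 (x + y) z = m1 x z + m1 y z"
      by (rule inj_onD[OF inj]) (simp_all add: x y z f T.mult_add_left)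
    show "m1 x (y + z) = m1 x y + m1 x z"
      by (rule inj_onD[OF inj]) (simp_all add: x y z f T.mult_add_right)
    show "m1 (m1 x y) z = m1 x (m1 y z)"
      by (rule inj_onD[OF inj]) (simp_all add: x y z f T.mult_assoc)
    show "m1 x (m1 y z) = m1 x (m1 z y)"
      by (rule inj_onD[OF inj]) (simp_all add: x y z f T.mult_perm[OF im im im])
  qed
qed

section \<open>Graphs of linear maps in a complemented perm algebra\<close>

text \<open>A perm algebra \<open>E\<close> with a subalgebra \<open>A\<close> and a fixed \<open>A\<close>-complement \<open>V\<close>.\<close>

locale complemented_perm_algebra = perm_algebra scale E mult
  for scale :: "'k::field_char_0 \<Rightarrow> 'a::ab_group_add \<Rightarrow> 'a" and E mult +
  fixes A V :: "'a set"
  assumes subalgebra: "perm_subalgebra scale E mult A"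
    and complement: "is_complement scale E mult A V"
begin

lemma A_subspace: "subspace A" and A_sub: "a \<in> A \<Longrightarrow> a \<in> E"
  and A_mult: "a \<in> A \<Longrightarrow> a' \<in> A \<Longrightarrow> mult a a' \<in> A"
  using subalgebra by (auto simp: perm_subalgebra_def)

lemma V_subspace: "subspace V" and V_sub: "v \<in> V \<Longrightarrow> v \<in> E"
  and V_mult: "v \<in> V \<Longrightarrow> w \<in> V \<Longrightarrow> mult v w \<in> V"
  using complement by (auto simp: is_complement_def perm_subalgebra_def)

lemma complement_decomp:
  assumes "is_complement scale E mult A B" "x \<in> E"
  obtains a b where "a \<in> A" "b \<in> B" "x = a + b"
  using assms by (auto simp: is_complement_def)

lemma complement_unique:
  assumes "is_complement scale E mult A B"
    and "a \<in> A" "a' \<in> A" "b \<in> B" "b' \<in> B" "a + b = a' + b'"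
  shows "a = a'" "b = b'"
proof -
  have B: "subspace B" and int: "A \<inter> B = {0}"
    using assms(1) by (auto simp: is_complement_def perm_subalgebra_def)
  have "a - a' = b' - b"
    using assms(6) by (simp add: algebra_simps)
  then have "a - a' \<in> A \<inter> B"
    using subspace_diff[OF A_subspace assms(2,3)] subspace_diff[OF B assms(5,4)] by simp
  then show "a = a'" "b = b'"
    using int assms(6) by auto
qed

text \<open>The graph of \<open>\<psi> : V \<rightarrow> A\<close>, with the pair \<open>(\<psi> v, v)\<close> read as the element \<open>\<psi> v + v\<close> of
  \<open>E = A \<oplus> V\<close>.\<close>

definition graph :: "('a \<Rightarrow> 'a) \<Rightarrow> 'a set"
  where "graph \<psi> = (\<lambda>v. \<psi> v + v) ` V"

lemma graphI: "v \<in> V \<Longrightarrow> \<psi> v + v \<in> graph \<psi>"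
  by (simp add: graph_def)

abbreviation dmult :: "('a \<Rightarrow> 'a) \<Rightarrow> 'a \<Rightarrow> 'a \<Rightarrow> 'a"
  where "dmult \<equiv> deformed_mult A V mult"

lemmas matched_pair = matched_pair_decomposition[OF perm_algebra_axioms subalgebra complement]

lemma deformed_mult_closed:
  assumes "\<psi> ` V \<subseteq> A" "v \<in> V" "w \<in> V"
  shows "dmult \<psi> v w \<in> V"
  using assms matched_pair(5,6) V_mult
  by (auto simp: deformed_mult_def image_subset_iff intro!: subspace_add[OF V_subspace])

text \<open>The decomposition of a product of graph elements along \<open>E = A \<oplus> V\<close>.\<close>

lemma graph_mult:
  assumes \<psi>: "\<psi> ` V \<subseteq> A" and v: "v \<in> V" and w: "w \<in> V"
  defines "a \<equiv> mult (\<psi> v) (\<psi> w) + white_left A V mult (\<psi> v) w + white_right A V mult v (\<psi> w)"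
  shows "mult (\<psi> v + v) (\<psi> w + w) = a + dmult \<psi> v w" "a \<in> A"
proof -
  have \<psi>A: "\<psi> v \<in> A" "\<psi> w \<in> A"
    using \<psi> v w by auto
  have E: "\<psi> v \<in> E" "\<psi> w \<in> E" "v \<in> E" "w \<in> E"
    using \<psi>A v w A_sub V_sub by auto
  have "mult (\<psi> v + v) (\<psi> w + w) = mult (\<psi> v) (\<psi> w) + mult (\<psi> v) w + mult v (\<psi> w) + mult v w"
    by (simp add: E mult_add_left mult_add_right subspace_add[OF subspace_carrier] add.assoc)
  then show "mult (\<psi> v + v) (\<psi> w + w) = a + dmult \<psi> v w"
    using matched_pair(1)[OF \<psi>A(1) w] matched_pair(2)[OF \<psi>A(2) v]
    by (simp add: a_def deformed_mult_def algebra_simps)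
  show "a \<in> A"
    unfolding a_def using \<psi>A v w matched_pair(3,4) A_mult
    by (intro subspace_add[OF A_subspace])
qed

text \<open>The deformation identity compares the \<open>A\<close>-components of the two sides below.\<close>

lemma deformation_map_iff_graph_mult:
  assumes \<psi>: "\<psi> ` V \<subseteq> A" and lin: "linear_on scale scale V \<psi>"
  shows "deformation_map scale A V mult \<psi> \<longleftrightarrow>
    (\<forall>v\<in>V. \<forall>w\<in>V. mult (\<psi> v + v) (\<psi> w + w) = \<psi> (dmult \<psi> v w) + dmult \<psi> v w)"
proof -
  have "\<psi> (mult v w) - mult (\<psi> v) (\<psi> w) =
        white_right A V mult v (\<psi> w) + white_left A V mult (\<psi> v) w
        - \<psi> (black_right A V mult (\<psi> v) w) - \<psi> (black_left A V mult v (\<psi> w)) \<longleftrightarrow>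
      mult (\<psi> v + v) (\<psi> w + w) = \<psi> (dmult \<psi> v w) + dmult \<psi> v w"
    if v: "v \<in> V" and w: "w \<in> V" for v w
  proof -
    have "\<psi> v \<in> A" "\<psi> w \<in> A"
      using \<psi> v w by auto
    then have V: "mult v w \<in> V" "black_right A V mult (\<psi> v) w \<in> V"
        "black_left A V mult v (\<psi> w) \<in> V"
      using v w V_mult matched_pair(5,6) by auto
    have "\<psi> (dmult \<psi> v w) =
        \<psi> (mult v w) + \<psi> (black_right A V mult (\<psi> v) w) + \<psi> (black_left A V mult v (\<psi> w))"
      using lin V subspace_add[OF V_subspace] by (simp add: deformed_mult_def linear_on_def)
    then show ?thesis
      unfolding graph_mult(1)[OF \<psi> v w] by (auto simp: algebra_simps)
  qed
  then show ?thesis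
    using \<psi> lin by (simp add: deformation_map_def)
qed

lemma graph_subspace:
  assumes \<psi>: "\<psi> ` V \<subseteq> A" and lin: "linear_on scale scale V \<psi>"
  shows "subspace (graph \<psi>)"
proof (rule subspaceI)
  have "\<psi> (scale 0 0) = scale 0 (\<psi> 0)"
    using lin subspace_0[OF V_subspace] unfolding linear_on_def by blast
  then show "0 \<in> graph \<psi>"
    using subspace_0[OF V_subspace] by (auto simp: graph_def intro!: image_eqI[where x = 0])
next
  fix x y assume "x \<in> graph \<psi>" "y \<in> graph \<psi>"
  then obtain v w where vw: "v \<in> V" "w \<in> V" "x = \<psi> v + v" "y = \<psi> w + w"
    by (auto simp: graph_def)
  then have "x + y = \<psi> (v + w) + (v + w)"
    using lin by (simp add: linear_on_def algebra_simps)
  then show "x + y \<in> graph \<psi>"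
    using graphI[OF subspace_add[OF V_subspace vw(1,2)]] by (simp only:)
next
  fix c x assume "x \<in> graph \<psi>"
  then obtain v where v: "v \<in> V" "x = \<psi> v + v"
    by (auto simp: graph_def)
  then have "scale c x = \<psi> (scale c v) + scale c v"
    using lin by (simp add: linear_on_def scale_right_distrib)
  then show "scale c x \<in> graph \<psi>"
    using graphI[OF subspace_scale[OF V_subspace v(1)]] by (simp only:)
qed

lemma graph_sub:
  assumes "\<psi> ` V \<subseteq> A"
  shows "graph \<psi> \<subseteq> E"
  using assms A_sub V_sub subspace_add[OF subspace_carrier] by (auto simp: graph_def)

lemma deformation_map_iff_subalgebra_graph:
  assumes \<psi>: "\<psi> ` V \<subseteq> A" and lin: "linear_on scale scale V \<psi>"
  shows "deformation_map scale A V mult \<psi> \<longleftrightarrow> perm_subalgebra scale E mult (graph \<psi>)"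
proof -
  have "mult (\<psi> v + v) (\<psi> w + w) = \<psi> (dmult \<psi> v w) + dmult \<psi> v w \<longleftrightarrow>
      mult (\<psi> v + v) (\<psi> w + w) \<in> graph \<psi>" if v: "v \<in> V" and w: "w \<in> V" for v w
  proof
    assume "mult (\<psi> v + v) (\<psi> w + w) = \<psi> (dmult \<psi> v w) + dmult \<psi> v w"
    then show "mult (\<psi> v + v) (\<psi> w + w) \<in> graph \<psi>"
      using deformed_mult_closed[OF \<psi> v w] by (auto simp: graph_def)
  next
    assume "mult (\<psi> v + v) (\<psi> w + w) \<in> graph \<psi>"
    then obtain u where u: "u \<in> V" "mult (\<psi> v + v) (\<psi> w + w) = \<psi> u + u"
      by (auto simp: graph_def)
    \<comment> \<open>The \<open>V\<close>-component of a graph element determines it, and here it is the deformed product.\<close>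
    have "\<psi> u \<in> A"
      using \<psi> u(1) by auto
    then have "u = dmult \<psi> v w"
      using graph_mult(2)[OF \<psi> v w] u(1) deformed_mult_closed[OF \<psi> v w]
        u(2)[unfolded graph_mult(1)[OF \<psi> v w], symmetric]
      by (rule complement_unique(2)[OF complement])
    then show "mult (\<psi> v + v) (\<psi> w + w) = \<psi> (dmult \<psi> v w) + dmult \<psi> v w"
      using u(2) by simp
  qed
  then show ?thesis
    using graph_sub[OF \<psi>] graph_subspace[OF \<psi> lin]
    by (simp add: deformation_map_iff_graph_mult[OF \<psi> lin] perm_subalgebra_def)
      (simp add: graph_def)
qed

section \<open>Complements as graphs of deformation maps\<close>

lemma graph_is_complement:
  assumes def: "deformation_map scale A V mult \<psi>"
  shows "is_complement scale E mult A (graph \<psi>)"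
proof -
  have \<psi>: "\<psi> ` V \<subseteq> A" and lin: "linear_on scale scale V \<psi>"
    using def by (auto simp: deformation_map_def)
  have sub: "perm_subalgebra scale E mult (graph \<psi>)"
    using def deformation_map_iff_subalgebra_graph[OF \<psi> lin] by simp
  have "\<exists>a b. x = a + b \<and> a \<in> A \<and> b \<in> graph \<psi>" if "x \<in> E" for x
  proof -
    obtain a v where av: "a \<in> A" "v \<in> V" "x = a + v"
      using complement_decomp[OF complement \<open>x \<in> E\<close>] .
    then have "x = (a - \<psi> v) + (\<psi> v + v)" "a - \<psi> v \<in> A" "\<psi> v + v \<in> graph \<psi>"
      using \<psi> subspace_diff[OF A_subspace] by (auto simp: graph_def)
    then show ?thesis by blast
  qed
  moreover have "a + b \<in> E" if "a \<in> A" "b \<in> graph \<psi>" for a b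
    using that A_sub graph_sub[OF \<psi>] subspace_add[OF subspace_carrier] by blast
  moreover have "x = 0" if x: "x \<in> A" "x \<in> graph \<psi>" for x
  proof -
    obtain v where v: "v \<in> V" "x = \<psi> v + v"
      using x(2) by (auto simp: graph_def)
    have "\<psi> v \<in> A" "x + 0 = \<psi> v + v"
      using \<psi> v by auto
    then have "0 = v"
      using complement_unique(2)[OF complement x(1) _ subspace_0[OF V_subspace] v(1)] by metis
    moreover have "\<psi> (scale 0 0) = scale 0 (\<psi> 0)"
      using lin subspace_0[OF V_subspace] unfolding linear_on_def by blast
    ultimately show ?thesis
      using v(2) by simp
  qed
  ultimately show ?thesis
    using sub subspace_0[OF A_subspace] subspace_0[OF graph_subspace[OF \<psi> lin]]
    by (auto simp: is_complement_def)
qed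

text \<open>Every complement \<open>B\<close> is the graph of the map sending \<open>v\<close> to the unique \<open>a \<in> A\<close> with
  \<open>a + v \<in> B\<close>.  This map is linear because \<open>B\<close> is a subspace, and a deformation map because \<open>B\<close> is
  closed under the product.\<close>

lemma complement_eq_graph:
  assumes B: "is_complement scale E mult A B"
  obtains \<psi> where "deformation_map scale A V mult \<psi>" "graph \<psi> = B"
proof -
  have Bsub: "subspace B" and BE: "\<And>b. b \<in> B \<Longrightarrow> b \<in> E"
      and Balg: "perm_subalgebra scale E mult B"
    using B by (auto simp: is_complement_def perm_subalgebra_def)
  have "\<exists>a. a \<in> A \<and> a + v \<in> B" if v: "v \<in> V" for v
  proof -
    obtain a b where ab: "a \<in> A" "b \<in> B" "v = a + b"
      using complement_decomp[OF B V_sub[OF v]] .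
    then have "- a \<in> A" "- a + v \<in> B"
      using subspace_neg[OF A_subspace] by auto
    then show ?thesis by blast
  qed
  then obtain \<psi> where \<psi>: "\<And>v. v \<in> V \<Longrightarrow> \<psi> v \<in> A" "\<And>v. v \<in> V \<Longrightarrow> \<psi> v + v \<in> B"
    by metis
  have unique: "\<psi> v = a" if "v \<in> V" "a \<in> A" "a + v \<in> B" for v a
  proof -
    have "\<psi> v + (a + v) = a + (\<psi> v + v)"
      by (simp add: algebra_simps)
    then show ?thesis
      by (rule complement_unique(1)[OF B \<psi>(1)[OF that(1)] that(2,3) \<psi>(2)[OF that(1)]])
  qed
  have "\<psi> (v + w) = \<psi> v + \<psi> w" if "v \<in> V" "w \<in> V" for v w
  proof (rule unique)
    have "\<psi> v + \<psi> w + (v + w) = (\<psi> v + v) + (\<psi> w + w)"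
      by (simp add: algebra_simps)
    then show "\<psi> v + \<psi> w + (v + w) \<in> B"
      using subspace_add[OF Bsub \<psi>(2)[OF that(1)] \<psi>(2)[OF that(2)]] by metis
  qed (use \<psi>(1) that in \<open>auto intro: subspace_add A_subspace V_subspace\<close>)
  moreover have "\<psi> (scale c v) = scale c (\<psi> v)" if "v \<in> V" for c v
  proof (rule unique)
    have "scale c (\<psi> v) + scale c v = scale c (\<psi> v + v)"
      by (simp add: scale_right_distrib)
    then show "scale c (\<psi> v) + scale c v \<in> B"
      using subspace_scale[OF Bsub \<psi>(2)[OF that]] by simp
  qed (use \<psi>(1) that in \<open>auto intro: subspace_scale A_subspace V_subspace\<close>)
  ultimately have lin: "linear_on scale scale V \<psi>"
    by (simp add: linear_on_def)
  have "b \<in> graph \<psi>" if b: "b \<in> B" for b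
  proof -
    obtain a v where "a \<in> A" "v \<in> V" "b = a + v"
      using complement_decomp[OF complement BE[OF b]] .
    then show ?thesis
      using b unique by (auto simp: graph_def)
  qed
  then have graph: "graph \<psi> = B"
    using \<psi>(2) by (auto simp: graph_def)
  have "\<psi> ` V \<subseteq> A"
    using \<psi>(1) by auto
  with lin graph Balg that show thesis
    using deformation_map_iff_subalgebra_graph by blast
qed

section \<open>Deformed algebras and the classification of complements\<close>

lemma deformation_iso_graph:
  assumes def: "deformation_map scale A V mult \<psi>"
  shows "perm_algebra scale V (dmult \<psi>)"
    and "perm_isomorphic scale V (dmult \<psi>) scale (graph \<psi>) mult"
proof -
  define f where "f v = \<psi> v + v" for v
  have \<psi>: "\<psi> ` V \<subseteq> A" and lin: "linear_on scale scale V \<psi>"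
    using def by (auto simp: deformation_map_def)
  have f_lin: "linear_on scale scale V f"
    using lin by (simp add: f_def linear_on_def scale_right_distrib algebra_simps)
  have f_inj: "inj_on f V"
  proof (rule inj_onI)
    fix v w assume v: "v \<in> V" and w: "w \<in> V" and eq: "f v = f w"
    have "\<psi> v \<in> A" "\<psi> w \<in> A"
      using \<psi> v w by auto
    then show "v = w"
      using v w eq[unfolded f_def] by (rule complement_unique(2)[OF complement])
  qed
  have f_hom: "f (dmult \<psi> v w) = mult (f v) (f w)" if "v \<in> V" "w \<in> V" for v w
    using def deformation_map_iff_graph_mult[OF \<psi> lin] that by (simp add: f_def)
  have f_graph: "f ` V = graph \<psi>"
    by (simp add: f_def graph_def)
  then have f_im: "f v \<in> E" if "v \<in> V" for v
    using that graph_sub[OF \<psi>] by blast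
  show "perm_algebra scale V (dmult \<psi>)"
  proof (rule perm_algebra_pullback)
    show "perm_algebra scale E mult" by (rule perm_algebra_axioms)
    show "vector_space scale" by (rule vector_space_axioms)
    show "subspace V" by (rule V_subspace)
    show "linear_on scale scale V f" by (rule f_lin)
    show "inj_on f V" by (rule f_inj)
    show "f (dmult \<psi> v w) = mult (f v) (f w)" if "v \<in> V" "w \<in> V" for v w
      using that by (rule f_hom)
  qed (simp_all add: f_im deformed_mult_closed[OF \<psi>])
  show "perm_isomorphic scale V (dmult \<psi>) scale (graph \<psi>) mult"
    unfolding perm_isomorphic_def
  proof (intro exI[of _ f] conjI ballI)
    show "bij_betw f V (graph \<psi>)"
      using f_inj f_graph by (simp add: bij_betw_def)
  qed (fact f_lin, rule f_hom)
qed

end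

theorem theorem2p18:
  fixes scale :: "'k::field_char_0 \<Rightarrow> 'a::ab_group_add \<Rightarrow> 'a"
    and mult :: "'a \<Rightarrow> 'a \<Rightarrow> 'a"
    and E A V :: "'a set"
  assumes "perm_algebra scale E mult"
    and "perm_subalgebra scale E mult A"
    and "is_complement scale E mult A V"
  shows "(\<forall>\<psi>. deformation_map scale A V mult \<psi> \<longrightarrow>
            perm_algebra scale V (deformed_mult A V mult \<psi>) \<and>
            (\<exists>B. is_complement scale E mult A B \<and>
                 perm_isomorphic scale V (deformed_mult A V mult \<psi>) scale B mult))
       \<and> (\<forall>(scale' :: 'k \<Rightarrow> 'b::ab_group_add \<Rightarrow> 'b) V' mult'. perm_algebra scale' V' mult' \<longrightarrow>
            ((\<exists>B. is_complement scale E mult A B \<and>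
                  perm_isomorphic scale' V' mult' scale B mult)
             \<longleftrightarrow>
             (\<exists>\<psi>. deformation_map scale A V mult \<psi> \<and>
                  perm_isomorphic scale' V' mult' scale V (deformed_mult A V mult \<psi>))))"
proof -
  interpret complemented_perm_algebra scale E mult A V
    using assms by (intro complemented_perm_algebra.intro complemented_perm_algebra_axioms.intro)
  show ?thesis
  proof (intro conjI allI impI)
    fix \<psi> assume def: "deformation_map scale A V mult \<psi>"
    show "perm_algebra scale V (deformed_mult A V mult \<psi>)"
      using def by (rule deformation_iso_graph)
    show "\<exists>B. is_complement scale E mult A B \<and>
        perm_isomorphic scale V (deformed_mult A V mult \<psi>) scale B mult"
      using graph_is_complement[OF def] deformation_iso_graph(2)[OF def] by blast
  next
    fix scale' :: "'k \<Rightarrow> 'b \<Rightarrow> 'b" and V' mult'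
    show "(\<exists>B. is_complement scale E mult A B \<and> perm_isomorphic scale' V' mult' scale B mult) \<longleftrightarrow>
        (\<exists>\<psi>. deformation_map scale A V mult \<psi> \<and>
          perm_isomorphic scale' V' mult' scale V (deformed_mult A V mult \<psi>))"
    proof (intro iffI; elim exE conjE)
      fix B assume B: "is_complement scale E mult A B"
        and iso: "perm_isomorphic scale' V' mult' scale B mult"
      obtain \<psi> where def: "deformation_map scale A V mult \<psi>" and "graph \<psi> = B"
        using complement_eq_graph[OF B] .
      then have "perm_isomorphic scale B mult scale V (deformed_mult A V mult \<psi>)"
        using perm_isomorphic_sym deformation_iso_graph[OF def] by blast
      then show "\<exists>\<psi>. deformation_map scale A V mult \<psi> \<and>
          perm_isomorphic scale' V' mult' scale V (deformed_mult A V mult \<psi>)"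
        using def perm_isomorphic_trans[OF iso] by blast
    next
      fix \<psi> assume def: "deformation_map scale A V mult \<psi>"
        and iso: "perm_isomorphic scale' V' mult' scale V (deformed_mult A V mult \<psi>)"
      show "\<exists>B. is_complement scale E mult A B \<and> perm_isomorphic scale' V' mult' scale B mult"
        using graph_is_complement[OF def]
          perm_isomorphic_trans[OF iso deformation_iso_graph(2)[OF def]] by blast
    qed
  qed
qed

end
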